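(* Let $(M,\leq,\odot,\rightarrow,\bot,\top)$ be a complete residuated multilattice. For any reflexive $M$-fuzzy approximation space $(X,R)$ the following properties hold: (i) $\underline{R}(\Downarrow)=\Downarrow$; (ii) $\overline{R}(\Uparrow)=\Uparrow$.
   Context: For a subset $S$ of a poset $(P,\leq)$, $\sqcup S$ is the set of minimal elements of the set of upper bounds of $S$, and $\sqcap S$ is the set of maximal elements of the set of lower bounds of $S$. A poset $(M,\leq)$ is a multilattice if for all $a,b,x\in M$: $a,b\leq x$ implies there is $z\in\sqcup\{a,b\}$ with $z\leq x$, and $a,b\geq x$ implies there is $z\in\sqcap\{a,b\}$ with $z\geq x$. It is a complete multilattice if moreover $\sqcup S$ and $\sqcap S$ are nonempty for every $S\subseteq M$. A pocrim is a structure $(A,\leq,\odot,\rightarrow,\top)$ where $(A,\leq)$ is a poset with top element $\top$, $(A,\odot,\top)$ is a commutative monoid with neutral element $\top$, and $a\odot b\leq c\iff a\leq b\rightarrow c$ for all $a,b,c\in A$. A complete residuated multilattice $(M,\leq,\odot,\rightarrow,\bot,\top)$ is a pocrim with bottom element $\bot$ whose underlying poset is a complete multilattice. An $M$-fuzzy approximation space is a pair $(X,R)$ with $X$ a nonempty set and $R:X\times X\to M$ (a binary $M$-fuzzy relation). $M^X$ is the set of all maps $X\to M$ ($M$-fuzzy sets), ordered pointwise; $\Uparrow,\Downarrow\in M^X$ are the constant maps with values $\top$ and $\bot$ respectively. For $f\in M^X$ and $x\in X$, $$\underline{R}(f)(x):=\bigwedge_{y\in X}(R(x,y)\rightarrow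 f(y)),\qquad \overline{R}(f)(x):=\bigvee_{y\in X}(R(x,y)\odot f(y)),$$ where $\bigwedge$ and $\bigvee$ denote infimum and supremum in $M$ (the paper asserts that these exist for every complete residuated multilattice). $(X,R)$ is reflexive if $R(x,x)=\top$ for every $x\in X$. *)

theory Defs
  imports Main
begin

definition (in ord) upper_bounds :: "'a set \<Rightarrow> 'a set" where
  "upper_bounds S = {u. \<forall>s\<in>S. s \<le> u}"

definition (in ord) lower_bounds :: "'a set \<Rightarrow> 'a set" where
  "lower_bounds S = {l. \<forall>s\<in>S. l \<le> s}"

definition (in ord) multi_suprema :: "'a set \<Rightarrow> 'a set" where
  "multi_suprema S = {z \<in> upper_bounds S. \<forall>w\<in>upper_bounds S. w \<le> z \<longrightarrow> w = z}"

definition (in ord) multi_infima :: "'a set \<Rightarrow> 'a set" where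
  "multi_infima S = {z \<in> lower_bounds S. \<forall>w\<in>lower_bounds S. z \<le> w \<longrightarrow> w = z}"

class multilattice = order +
  assumes ex_multi_supremum_le:
      "a \<le> x \<Longrightarrow> b \<le> x \<Longrightarrow> \<exists>z\<in>multi_suprema {a, b}. z \<le> x"
    and ex_multi_infimum_ge:
      "x \<le> a \<Longrightarrow> x \<le> b \<Longrightarrow> \<exists>z\<in>multi_infima {a, b}. x \<le> z"

class complete_multilattice = multilattice +
  assumes multi_suprema_nonempty: "multi_suprema S \<noteq> {}"
    and multi_infima_nonempty: "multi_infima S \<noteq> {}"

class pocrim = order_top +
  fixes odot :: "'a \<Rightarrow> 'a \<Rightarrow> 'a"  (infixl "\<odot>" 70)
    and residuum :: "'a \<Rightarrow> 'a \<Rightarrow> 'a"  (infixr "\<rightarrow>" 65)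
  assumes comm_monoid_odot: "comm_monoid (\<odot>) top"
    and residuation: "a \<odot> b \<le> c \<longleftrightarrow> a \<le> b \<rightarrow> c"

class complete_residuated_multilattice = pocrim + order_bot + complete_multilattice

text \<open>
  A fuzzy approximation space is a relation \<open>R :: 'x \<Rightarrow> 'x \<Rightarrow> 'm\<close>; its nonempty underlying
  set is the type \<open>'x\<close>.

  The infimum and supremum are those of the poset, i.e. the greatest lower and the least upper
  bound (not multi-infima or multi-suprema). Completeness as a multilattice does not make them
  exist for every family: as with any definite description, the two operators below are
  specified only at points where the bound exists.
\<close>

definition reflexive_space :: "('x \<Rightarrow> 'x \<Rightarrow> 'm::complete_residuated_multilattice) \<Rightarrow> bool" where
  "reflexive_space R \<longleftrightarrow> (\<forall>x. R x x = top)"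

definition lower_approx ::
  "('x \<Rightarrow> 'x \<Rightarrow> 'm::complete_residuated_multilattice) \<Rightarrow> ('x \<Rightarrow> 'm) \<Rightarrow> 'x \<Rightarrow> 'm" where
  "lower_approx R f x = (GREATEST l. l \<in> lower_bounds (range (\<lambda>y. R x y \<rightarrow> f y)))"

definition upper_approx ::
  "('x \<Rightarrow> 'x \<Rightarrow> 'm::complete_residuated_multilattice) \<Rightarrow> ('x \<Rightarrow> 'm) \<Rightarrow> 'x \<Rightarrow> 'm" where
  "upper_approx R f x = (LEAST u. u \<in> upper_bounds (range (\<lambda>y. R x y \<odot> f y)))"

end

theory Submission
  imports Defs
begin

text \<open>By reflexivity, the family evaluated at \<open>x\<close> has the diagonal member
  \<open>top \<rightarrow> bot = bot\<close>, respectively \<open>top \<odot> top = top\<close>. A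
  family containing \<open>bot\<close> has \<open>bot\<close> as its only lower bound, hence as its
  infimum; dually for \<open>top\<close>.\<close>

lemma odot_top_right: "a \<odot> top = (a :: 'a::pocrim)"
  by (rule comm_monoid.comm_neutral[OF comm_monoid_odot])

lemma residuum_top_left: "top \<rightarrow> a = (a :: 'a::pocrim)"
proof (rule order.antisym)
  show "top \<rightarrow> a \<le> a"
    using residuation[of "top \<rightarrow> a" top a] by (simp add: odot_top_right)
  show "a \<le> top \<rightarrow> a"
    using residuation[of a top a] by (simp add: odot_top_right)
qed

text \<open>The point of an exact singleton: the greatest lower bound then exists, so the
  description in \<open>lower_approx\<close> has a definite value.\<close>

lemma lower_bounds_eq_bot:
  fixes S :: "'a::order_bot set"
  assumes "bot \<in> S"
  shows "lower_bounds S = {bot}"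
  using assms by (auto simp: lower_bounds_def bot_unique)

lemma upper_bounds_eq_top:
  fixes S :: "'a::order_top set"
  assumes "top \<in> S"
  shows "upper_bounds S = {top}"
  using assms by (auto simp: upper_bounds_def top_unique)

theorem proposition4p1:
  fixes R :: "'x \<Rightarrow> 'x \<Rightarrow> 'm::complete_residuated_multilattice"
  assumes "reflexive_space R"
  shows "lower_approx R (\<lambda>_. bot) = (\<lambda>_. bot) \<and> upper_approx R (\<lambda>_. top) = (\<lambda>_. top)"
proof (intro conjI ext)
  fix x
  have refl: "R x x = top"
    using assms by (simp add: reflexive_space_def)
  \<comment> \<open>The witness is the diagonal index \<open>y = x\<close>, where
    \<open>refl\<close> makes the residuum collapse to \<open>bot\<close>.\<close>
  have "bot \<in> range (\<lambda>y. R x y \<rightarrow> bot)"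
    using refl by (intro range_eqI[of _ _ x]) (simp add: residuum_top_left)
  then show "lower_approx R (\<lambda>_. bot) x = bot"
    by (auto simp: lower_approx_def lower_bounds_eq_bot intro: Greatest_equality)
  have "top \<in> range (\<lambda>y. R x y \<odot> top)"
    using refl by (intro range_eqI[of _ _ x]) (simp add: odot_top_right)
  \<comment> \<open>The set of upper bounds is \<open>{top}\<close>, so its least element is
    \<open>top\<close>.\<close>
  then show "upper_approx R (\<lambda>_. top) x = top"
    by (auto simp: upper_approx_def upper_bounds_eq_top intro: Least_equality)
qed

end
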